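(* Let $v\ge w\ge t\ge 2$ be integers. Then $$N_t(w,v)\le \binom{v}{\left\lceil\frac{w}{\lfloor t^2/4\rfloor+t}\right\rceil}=O\left(v^{\left\lceil\frac{w}{\lfloor t^2/4\rfloor+t}\right\rceil}\right).$$
   Context: A set system is a pair $(\mathcal{X},\mathcal{B})$ where $\mathcal{X}$ is a finite set of points and $\mathcal{B}$ is a collection (set) of subsets of $\mathcal{X}$ called blocks; its size is $|\mathcal{B}|$. $\binom{\mathcal{X}}{w}$ denotes the collection of all $w$-subsets of $\mathcal{X}$. A $t$-parent-identifying set system $t$-IPPS$(w,v)$ is a set system $(\mathcal{X},\mathcal{B})$ with $|\mathcal{X}|=v$ and $\mathcal{B}\subseteq\binom{\mathcal{X}}{w}$ such that for any $w$-subset $T\subseteq\mathcal{X}$, either $P_t(T)$ is empty or $\bigcap_{\mathcal{P}\in P_t(T)}\mathcal{P}\ne\emptyset$, where $P_t(T)=\{\mathcal{P}\subseteq\mathcal{B}: |\mathcal{P}|\le t,\ T\subseteq\bigcup_{B\in\mathcal{P}}B\}$. $N_t(w,v)$ denotes the maximum size of a $t$-IPPS$(w,v)$. The $O(\cdot)$ is for $v\to\infty$ with $w$ and $t$ fixed. *)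

theory Defs
  imports Complex_Main "HOL-Library.Landau_Symbols"
begin

definition set_system :: "'a set \<Rightarrow> 'a set set \<Rightarrow> bool" where
  "set_system X B \<longleftrightarrow> finite X \<and> B \<subseteq> Pow X"

definition w_subsets :: "'a set \<Rightarrow> nat \<Rightarrow> 'a set set" where
  "w_subsets X w = {A. A \<subseteq> X \<and> card A = w}"

text \<open>The family \<open>P\<^sub>t(T)\<close>. It is only used for finite \<open>B\<close>, so that \<open>card\<close> is the true
  cardinality of \<open>P \<subseteq> B\<close>.\<close>
definition parent_sets :: "nat \<Rightarrow> 'a set set \<Rightarrow> 'a set \<Rightarrow> 'a set set set" where
  "parent_sets t B T = {P. P \<subseteq> B \<and> card P \<le> t \<and> T \<subseteq> \<Union>P}"

text \<open>The case of an empty family is separate because \<open>\<Inter>{} = UNIV\<close>.\<close>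
definition is_IPPS :: "nat \<Rightarrow> nat \<Rightarrow> nat \<Rightarrow> 'a set \<Rightarrow> 'a set set \<Rightarrow> bool" where
  "is_IPPS t w v X B \<longleftrightarrow> set_system X B \<and> card X = v \<and> B \<subseteq> w_subsets X w \<and>
     (\<forall>T \<in> w_subsets X w. parent_sets t B T = {} \<or> \<Inter>(parent_sets t B T) \<noteq> {})"

definition IPPS_sizes :: "nat \<Rightarrow> nat \<Rightarrow> nat \<Rightarrow> nat set" where
  "IPPS_sizes t w v = {card B |(X :: nat set) B. is_IPPS t w v X B}"

text \<open>\<open>N\<^sub>t(w,v)\<close>. Taking the points to be natural numbers loses no generality, and the maximum
  ranges over a finite nonempty set; see \<open>is_IPPS_size\<close>, \<open>finite_IPPS_sizes\<close> and
  \<open>IPPS_sizes_nonempty\<close>.\<close>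
definition max_IPPS :: "nat \<Rightarrow> nat \<Rightarrow> nat \<Rightarrow> nat" where
  "max_IPPS t w v = Max (IPPS_sizes t w v)"

definition IPPS_exponent :: "nat \<Rightarrow> nat \<Rightarrow> nat" where
  "IPPS_exponent t w = nat \<lceil>real w / (real_of_int \<lfloor>(real t)\<^sup>2 / 4\<rfloor> + real t)\<rceil>"

lemma finite_IPPS_sizes: "finite (IPPS_sizes t w v)"
proof (rule finite_subset)
  show "IPPS_sizes t w v \<subseteq> {..2 ^ v}"
  proof
    fix n assume "n \<in> IPPS_sizes t w v"
    then obtain X :: "nat set" and B where "n = card B" "finite X" "card X = v" "B \<subseteq> Pow X"
      by (auto simp: IPPS_sizes_def is_IPPS_def set_system_def)
    then show "n \<in> {..2 ^ v}"
      using card_mono[of "Pow X" B] by (simp add: card_Pow)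
  qed
qed simp

lemma is_IPPS_empty:
  assumes "finite X" "card X = v" "w > 0"
  shows "is_IPPS t w v X {}"
proof -
  have "parent_sets t {} T = {}" if "T \<in> w_subsets X w" for T
    using that assms by (auto simp: parent_sets_def w_subsets_def)
  then show ?thesis
    using assms by (simp add: is_IPPS_def set_system_def)
qed

lemma IPPS_sizes_nonempty: "w > 0 \<Longrightarrow> IPPS_sizes t w v \<noteq> {}"
  using is_IPPS_empty[of "{..<v}" v w t] unfolding IPPS_sizes_def by auto

lemma is_IPPS_image:
  fixes f :: "'a \<Rightarrow> 'b"
  assumes ipps: "is_IPPS t w v X B" and inj: "inj_on f X"
  shows "is_IPPS t w v (f ` X) ((`) f ` B)"
    and "card ((`) f ` B) = card B"
proof -
  have X: "finite X" "card X = v" and BP: "B \<subseteq> Pow X" and BW: "B \<subseteq> w_subsets X w"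
    and par: "\<And>T. T \<in> w_subsets X w \<Longrightarrow> parent_sets t B T = {} \<or> \<Inter>(parent_sets t B T) \<noteq> {}"
    using ipps by (auto simp: is_IPPS_def set_system_def)
  have injP: "inj_on ((`) f) (Pow X)"
    using inj by (simp add: inj_on_image_Pow)
  have injB: "inj_on ((`) f) B"
    using injP BP by (rule inj_on_subset)
  show "card ((`) f ` B) = card B"
    using injB by (rule card_image)
  have cardf: "card (f ` A) = card A" if "A \<subseteq> X" for A
    using card_image[OF inj_on_subset[OF inj that]] .
  have parent: "parent_sets t ((`) f ` B) (f ` T) = (`) ((`) f) ` parent_sets t B T"
    if T: "T \<subseteq> X" for T
  proof -
    have key: "(`) f ` P \<in> parent_sets t ((`) f ` B) (f ` T) \<longleftrightarrow> P \<in> parent_sets t B T"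
      if P: "P \<subseteq> B" for P
    proof -
      have "card ((`) f ` P) = card P"
        using card_image[OF inj_on_subset[OF injB P]] .
      moreover have "\<Union>P \<subseteq> X" using P BP by blast
      then have "f ` T \<subseteq> f ` \<Union>P \<longleftrightarrow> T \<subseteq> \<Union>P"
        using inj T unfolding inj_on_def by blast
      moreover have "\<Union>((`) f ` P) = f ` \<Union>P" by blast
      moreover have "(`) f ` P \<subseteq> (`) f ` B" using P by blast
      ultimately show ?thesis using P by (simp add: parent_sets_def)
    qed
    show ?thesis
    proof (intro equalityI subsetI)
      fix Q assume Q: "Q \<in> parent_sets t ((`) f ` B) (f ` T)"
      then have "Q \<subseteq> (`) f ` B" by (simp add: parent_sets_def)
      then obtain P where P: "P \<subseteq> B" "Q = (`) f ` P" by (auto simp: subset_image_iff)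
      with key Q show "Q \<in> (`) ((`) f) ` parent_sets t B T" by blast
    next
      fix Q assume "Q \<in> (`) ((`) f) ` parent_sets t B T"
      then obtain P where P: "P \<in> parent_sets t B T" "Q = (`) f ` P" by blast
      then have "P \<subseteq> B" by (simp add: parent_sets_def)
      with key P show "Q \<in> parent_sets t ((`) f ` B) (f ` T)" by blast
    qed
  qed
  have "parent_sets t ((`) f ` B) S = {} \<or> \<Inter>(parent_sets t ((`) f ` B) S) \<noteq> {}"
    if S: "S \<in> w_subsets (f ` X) w" for S
  proof -
    have "S \<subseteq> f ` X" using S by (simp add: w_subsets_def)
    then obtain T where T: "T \<subseteq> X" "S = f ` T" by (auto simp: subset_image_iff)
    then have "T \<in> w_subsets X w" using S cardf by (simp add: w_subsets_def)
    then consider "parent_sets t B T = {}" | b where "b \<in> \<Inter>(parent_sets t B T)"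
      using par by blast
    then show ?thesis
    proof cases
      case 1
      then show ?thesis using parent T by simp
    next
      case 2
      then have "f ` b \<in> \<Inter>(parent_sets t ((`) f ` B) S)"
        using parent[OF T(1)] T(2) by simp
      then show ?thesis by blast
    qed
  qed
  moreover have "(`) f ` B \<subseteq> w_subsets (f ` X) w"
    using BW cardf by (auto simp: w_subsets_def)
  moreover have "(`) f ` B \<subseteq> Pow (f ` X)" using BP by blast
  ultimately show "is_IPPS t w v (f ` X) ((`) f ` B)"
    using X cardf by (simp add: is_IPPS_def set_system_def)
qed

lemma is_IPPS_size:
  fixes X :: "'a set"
  assumes "is_IPPS t w v X B"
  shows "card B \<in> IPPS_sizes t w v" and "card B \<le> max_IPPS t w v"
proof -
  have "finite X" using assms by (simp add: is_IPPS_def set_system_def)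
  then obtain f :: "'a \<Rightarrow> nat" where "inj_on f X"
    using finite_imp_inj_to_nat_seg by blast
  from is_IPPS_image[OF assms this] show *: "card B \<in> IPPS_sizes t w v"
    unfolding IPPS_sizes_def by (metis (mono_tags, lifting) mem_Collect_eq)
  show "card B \<le> max_IPPS t w v"
    unfolding max_IPPS_def using finite_IPPS_sizes * by (rule Max_ge)
qed

end

theory Submission
  imports Defs
begin

text \<open>
  Put \<open>k\<close> for the exponent, \<open>p = \<lfloor>t/2\<rfloor> + 1\<close> and \<open>q = \<lceil>t/2\<rceil>\<close>, so that \<open>p + q = t + 1\<close> and
  \<open>p q + p - 1 = \<lfloor>t\<^sup>2/4\<rfloor> + t\<close>. Repeatedly deleting a block that has a \<open>k\<close>-subset contained in no
  other remaining block assigns distinct \<open>k\<close>-subsets to the deleted blocks. So if there are more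
  than \<open>v choose k\<close> blocks, some nonempty subfamily survives, in which every \<open>k\<close>-subset of a block
  lies in a second block. In it one grows a graph on blocks, each edge \<open>cy\<close> contributing up to \<open>k\<close>
  points of \<open>c \<inter> y\<close> to a set \<open>T\<close>: at most \<open>p\<close> blocks are centres, every edge has a centre as an
  endpoint, and every centre has at most \<open>q\<close> neighbours that are not centres. A centre with fewer
  such neighbours can receive a further edge; if there is none, a neighbour can be promoted to a
  centre, unless there are \<open>p\<close> centres already, and then there are \<open>p q + p - 1\<close> edges and \<open>T\<close> has
  \<open>w\<close> points. Now \<open>T\<close> is covered by the set of centres, and also, for each centre \<open>c\<close>, by the other
  centres together with the neighbours of \<open>c\<close> that are not centres. These sets have at most \<open>t\<close>
  blocks each and no block in common.
\<close>

section \<open>Families in which no block owns a \<open>k\<close>-subset\<close>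

definition no_own_subset :: "nat \<Rightarrow> 'a set set \<Rightarrow> bool" where
  "no_own_subset k F \<longleftrightarrow> (\<forall>A\<in>F. \<forall>S\<subseteq>A. card S = k \<longrightarrow> (\<exists>A'\<in>F. A' \<noteq> A \<and> S \<subseteq> A'))"

text \<open>Deleting a block that owns a \<open>k\<close>-subset \<open>S\<close> lowers the number
  of blocks by one and the number of covered \<open>k\<close>-subsets by at least one, since
  \<open>S\<close> is no longer covered.\<close>

lemma card_le_card_k_subsets:
  assumes "finite X" "finite B" "B \<subseteq> Pow X"
    and "\<And>F. F \<subseteq> B \<Longrightarrow> F \<noteq> {} \<Longrightarrow> \<not> no_own_subset k F"
  shows "card B \<le> card {S. card S = k \<and> (\<exists>A\<in>B. S \<subseteq> A)}"
  using assms(2-)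
proof (induction B rule: finite_psubset_induct)
  case (psubset B)
  let ?U = "\<lambda>B. {S. card S = k \<and> (\<exists>A\<in>B. S \<subseteq> A)}"
  show ?case
  proof (cases "B = {}")
    case False
    then have "\<not> no_own_subset k B" using psubset.prems(2) by blast
    then obtain A S where A: "A \<in> B" "S \<subseteq> A" "card S = k"
        and own: "\<And>A'. A' \<in> B \<Longrightarrow> A' \<noteq> A \<Longrightarrow> \<not> S \<subseteq> A'"
      unfolding no_own_subset_def by metis
    have "card (B - {A}) \<le> card (?U (B - {A}))"
    proof (rule psubset.IH)
      show "\<not> no_own_subset k F" if "F \<subseteq> B - {A}" "F \<noteq> {}" for F
        using that by (intro psubset.prems(2)) auto
      show "B - {A} \<subset> B" "B - {A} \<subseteq> Pow X" using psubset.prems(1) A(1) by blast+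
    qed
    moreover have "card (?U (B - {A})) < card (?U B)"
    proof (rule psubset_card_mono)
      show "finite (?U B)"
        by (rule finite_subset[of _ "Pow X"]) (use psubset.prems(1) assms(1) in \<open>blast, simp\<close>)
      show "?U (B - {A}) \<subset> ?U B"
      proof (rule psubsetI)
        show "?U (B - {A}) \<subseteq> ?U B" by blast
        have "S \<in> ?U B" using A by blast
        moreover have "S \<notin> ?U (B - {A})" using own by blast
        ultimately show "?U (B - {A}) \<noteq> ?U B" by metis
      qed
    qed
    ultimately show ?thesis
      using card_Suc_Diff1[OF psubset.hyps A(1)] by linarith
  qed simp
qed

lemma exists_no_own_subset:
  assumes "finite X" "B \<subseteq> Pow X" "card X choose k < card B"
  obtains F where "F \<subseteq> B" "F \<noteq> {}" "no_own_subset k F"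
proof (rule ccontr)
  assume "\<not> thesis"
  then have "\<And>F. F \<subseteq> B \<Longrightarrow> F \<noteq> {} \<Longrightarrow> \<not> no_own_subset k F" using that by blast
  moreover have "finite B" using assms(1,2) finite_subset by blast
  ultimately have "card B \<le> card {S. card S = k \<and> (\<exists>A\<in>B. S \<subseteq> A)}"
    using card_le_card_k_subsets assms(1,2) by blast
  also have "\<dots> \<le> card {S. S \<subseteq> X \<and> card S = k}"
    by (rule card_mono) (use assms(1,2) in auto)
  also have "\<dots> = card X choose k" using assms(1) by (rule n_subsets)
  finally show False using assms(3) by simp
qed

lemma exists_other_superset:
  assumes "no_own_subset k F" "A \<in> F" "finite A" "k \<le> card A" "S \<subseteq> A" "card S \<le> k"
  obtains A' where "A' \<in> F" "A' \<noteq> A" "S \<subseteq> A'"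
proof -
  \<comment> \<open>The last edge of the graph may need fewer than \<open>k\<close> points, so
    \<open>S\<close> is first padded to exactly \<open>k\<close> points inside
    \<open>A\<close>.\<close>
  obtain S' where "S \<subseteq> S'" "S' \<subseteq> A" "card S' = k"
    using exists_subset_between[OF assms(6,4,5,3)] by metis
  moreover from this obtain A' where "A' \<in> F" "A' \<noteq> A" "S' \<subseteq> A'"
    using assms(1,2) unfolding no_own_subset_def by metis
  ultimately show ?thesis using that[of A'] by simp
qed

section \<open>Graphs on blocks and covers without a common block\<close>

definition outer_nbrs :: "'a set set \<Rightarrow> ('a set \<times> 'a set) set \<Rightarrow> 'a set \<Rightarrow> 'a set set" where
  "outer_nbrs C E c = {y. (c, y) \<in> E} - C"

text \<open>Edges are ordered so that the first component is a centre; the second may be a centre or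
  not. \<open>T\<close> is only a subset of the union, as an edge may contribute just part of its
  intersection.\<close>

definition cover_graph ::
  "nat \<Rightarrow> nat \<Rightarrow> 'a set set \<Rightarrow> 'a set set \<Rightarrow> ('a set \<times> 'a set) set \<Rightarrow> 'a set \<Rightarrow> bool" where
  "cover_graph p q F C E T \<longleftrightarrow> C \<subseteq> F \<and> E \<subseteq> C \<times> F \<and> card C \<le> p \<and>
     (\<forall>(c, y)\<in>E. c \<noteq> y) \<and> (\<forall>c\<in>C. card (outer_nbrs C E c) \<le> q) \<and>
     T \<subseteq> (\<Union>(c, y)\<in>E. c \<inter> y)"

lemma cover_graph_no_common_block:
  assumes g: "cover_graph p q F C E T" and "F \<subseteq> B" "finite F" "1 \<le> q" "p + q \<le> Suc t"
  shows "parent_sets t B T \<noteq> {}" "\<Inter>(parent_sets t B T) = {}"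
proof -
  have C: "C \<subseteq> F" "E \<subseteq> C \<times> F" "card C \<le> p" "finite C"
    using g \<open>finite F\<close> finite_subset unfolding cover_graph_def by blast+
  have out: "\<And>c. c \<in> C \<Longrightarrow> card (outer_nbrs C E c) \<le> q"
    and loop: "\<And>c y. (c, y) \<in> E \<Longrightarrow> c \<noteq> y"
    and T: "\<And>x. x \<in> T \<Longrightarrow> \<exists>(c, y)\<in>E. x \<in> c \<and> x \<in> y"
    using g unfolding cover_graph_def by fastforce+
  have "T \<subseteq> \<Union>C" using T C(2) by fastforce
  then have centres: "C \<in> parent_sets t B T"
    using C assms(2,4,5) by (auto simp: parent_sets_def)
  then show "parent_sets t B T \<noteq> {}" by blast
  have avoid: "(C - {c}) \<union> outer_nbrs C E c \<in> parent_sets t B T" if c: "c \<in> C" for c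
  proof -
    have "T \<subseteq> \<Union>((C - {c}) \<union> outer_nbrs C E c)"
    proof
      fix x assume x: "x \<in> T"
      obtain c' y where e: "(c', y) \<in> E" "x \<in> c'" "x \<in> y" using T[OF x] by blast
      then have "c' \<in> C" "c' \<noteq> y" using C(2) loop by auto
      \<comment> \<open>If \<open>c' \<noteq> c\<close>, the centre \<open>c'\<close> still covers
        \<open>x\<close>. Otherwise \<open>y \<noteq> c\<close> is another centre or an outer
        neighbour of \<open>c\<close>.\<close>
      then show "x \<in> \<Union>((C - {c}) \<union> outer_nbrs C E c)"
        using e by (cases "c' = c") (auto simp: outer_nbrs_def)
    qed
    moreover have "card ((C - {c}) \<union> outer_nbrs C E c) \<le> card (C - {c}) + card (outer_nbrs C E c)"
      by (rule card_Un_le)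
    moreover have "card (C - {c}) < p" using c C(3,4) card_Diff1_less[of C c] by linarith
    moreover have "(C - {c}) \<union> outer_nbrs C E c \<subseteq> B"
      using C(1,2) assms(2) by (auto simp: outer_nbrs_def)
    ultimately show ?thesis
      using out[OF c] assms(5) unfolding parent_sets_def by simp
  qed
  have "A \<notin> \<Inter>(parent_sets t B T)" for A
  proof (cases "A \<in> C")
    case True
    then have "A \<notin> (C - {A}) \<union> outer_nbrs C E A" by (simp add: outer_nbrs_def)
    then show ?thesis using avoid[OF True] by blast
  qed (use centres in blast)
  then show "\<Inter>(parent_sets t B T) = {}" by blast
qed

text \<open>Edges leaving \<open>C\<close> and edges inside \<open>C\<close> are disjoint sets, and
  each centre is the source of at least \<open>q\<close> of the former.\<close>

lemma card_edges_ge: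
  assumes "finite E" "finite C" "\<And>c. c \<in> C \<Longrightarrow> q \<le> card (outer_nbrs C E c)"
  shows "card C * q + card (E \<inter> C \<times> C) \<le> card E"
proof -
  have fin: "finite (outer_nbrs C E c)" for c
    by (rule finite_subset[of _ "snd ` E"]) (use assms(1) in \<open>force simp: outer_nbrs_def\<close>)+
  have "card C * q \<le> (\<Sum>c\<in>C. card (outer_nbrs C E c))"
    using assms(3) sum_bounded_below[of C q "\<lambda>c. card (outer_nbrs C E c)"] by simp
  also have "\<dots> = card (SIGMA c:C. outer_nbrs C E c)"
    using assms(2) fin by simp
  finally have "card C * q + card (E \<inter> C \<times> C)
      \<le> card (SIGMA c:C. outer_nbrs C E c) + card (E \<inter> C \<times> C)" by simp
  also have "\<dots> = card ((SIGMA c:C. outer_nbrs C E c) \<union> (E \<inter> C \<times> C))"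
    by (rule card_Un_disjoint[symmetric]) (use assms fin in \<open>auto simp: outer_nbrs_def\<close>)
  also have "\<dots> \<le> card E"
    by (rule card_mono) (use assms(1) in \<open>auto simp: outer_nbrs_def\<close>)
  finally show ?thesis .
qed

section \<open>Growing the graph\<close>

text \<open>The invariant of the growth: on average each edge pays for \<open>k\<close> points of
  \<open>T\<close> until \<open>T\<close> has \<open>w\<close> points, and the centres span at least
  as many edges as a tree on them would.\<close>

definition dense_cover_graph ::
  "nat \<Rightarrow> nat \<Rightarrow> nat \<Rightarrow> nat \<Rightarrow> 'a set set \<Rightarrow> 'a set set \<Rightarrow> ('a set \<times> 'a set) set \<Rightarrow> 'a set \<Rightarrow> bool" where
  "dense_cover_graph k w p q F C E T \<longleftrightarrow> cover_graph p q F C E T \<and> card T \<le> w \<and>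
     min w (k * card E) \<le> card T \<and> card C \<le> Suc (card (E \<inter> C \<times> C))"

lemma add_edge:
  assumes F: "no_own_subset k F" "finite F" "\<And>A. A \<in> F \<Longrightarrow> finite A \<and> card A = w"
    and k: "1 \<le> k" "k \<le> w"
    and g: "dense_cover_graph k w p q F C E T"
    and T: "card T < w" "finite T" and c: "c \<in> C" "card (outer_nbrs C E c) < q"
  obtains E' T' where "dense_cover_graph k w p q F C E' T'" "card T < card T'"
proof -
  have cg: "C \<subseteq> F" "E \<subseteq> C \<times> F" "card C \<le> p"
      "\<And>c y. (c, y) \<in> E \<Longrightarrow> c \<noteq> y" "\<And>c. c \<in> C \<Longrightarrow> card (outer_nbrs C E c) \<le> q"
      "T \<subseteq> (\<Union>(c, y)\<in>E. c \<inter> y)"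
    and dense: "min w (k * card E) \<le> card T" "card C \<le> Suc (card (E \<inter> C \<times> C))"
    using g unfolding dense_cover_graph_def cover_graph_def by auto
  have cF: "c \<in> F" "finite c" "card c = w" using cg(1) c F(3) by auto
  have finE: "finite E" using cg(1,2) F(2) by (meson finite_SigmaI finite_subset)
  \<comment> \<open>As \<open>c\<close> has \<open>w\<close> points, it has enough points outside
    \<open>T\<close> to supply \<open>k\<close> new ones, or as many as \<open>T\<close> still
    lacks.\<close>
  have "min k (w - card T) \<le> card (c - T)"
    using cF(3) diff_card_le_card_Diff[OF T(2), of c] by linarith
  then obtain S where S: "S \<subseteq> c - T" "card S = min k (w - card T)" "finite S"
    by (rule obtain_subset_with_card_n)
  then have "S \<subseteq> c" "card S \<le> k" "k \<le> card c" using cF(3) k(2) by auto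
  then obtain y where y: "y \<in> F" "y \<noteq> c" "S \<subseteq> y"
    using exists_other_superset[OF F(1) cF(1,2)] by metis
  let ?E = "insert (c, y) E" and ?T = "T \<union> S"
  have cT: "card ?T = card T + min k (w - card T)"
    using S T(2) by (subst card_Un_disjoint) auto
  have "outer_nbrs C ?E c \<subseteq> insert y (outer_nbrs C E c)" by (auto simp: outer_nbrs_def)
  moreover have finc: "finite (outer_nbrs C E c)"
    by (rule finite_subset[OF _ F(2)]) (use cg(2) in \<open>auto simp: outer_nbrs_def\<close>)
  ultimately have "card (outer_nbrs C ?E c) \<le> card (insert y (outer_nbrs C E c))"
    by (intro card_mono) auto
  also have "\<dots> \<le> q" using c(2) finc by (simp add: card_insert_if)
  finally have "card (outer_nbrs C ?E d) \<le> q" if "d \<in> C" for d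
    using cg(5)[OF that] by (cases "d = c") (auto simp: outer_nbrs_def)
  moreover have "?T \<subseteq> (\<Union>(c, y)\<in>?E. c \<inter> y)" using cg(6) y(3) S(1) by auto
  moreover have "\<forall>(d, z)\<in>?E. d \<noteq> z" using cg(4) y(2) by blast
  moreover have "?E \<subseteq> C \<times> F" using cg(2) y(1) c(1) by blast
  ultimately have "cover_graph p q F C ?E ?T"
    unfolding cover_graph_def using cg(1,3) by blast
  moreover have "min w (k * card ?E) \<le> card ?T"
  proof -
    \<comment> \<open>Only an inequality, since \<open>(c, y)\<close> may already be an edge;
      \<open>T\<close> grows in either case.\<close>
    have "k * card ?E \<le> k * card E + k" using finE by (simp add: card_insert_if)
    then show ?thesis using dense(1) T(1) cT by (auto simp: min_def split: if_splits)
  qed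
  moreover have "card (E \<inter> C \<times> C) \<le> card (?E \<inter> C \<times> C)"
    by (rule card_mono) (use finE in auto)
  ultimately have "dense_cover_graph k w p q F C ?E ?T"
    unfolding dense_cover_graph_def using dense(2) cT T(1) by simp
  moreover have "card T < card ?T" using cT T(1) k(1) by simp
  ultimately show ?thesis by (rule that)
qed

text \<open>Edges start at centres, so \<open>y\<close> has no outgoing edge and hence no outer
  neighbour; the other outer neighbourhoods can only shrink. The edge from \<open>c\<close> to
  \<open>y\<close> becomes an inner edge and pays for the new centre.\<close>

lemma promote_nbr:
  assumes g: "dense_cover_graph k w p q F C E T" and "finite F"
    and C: "card C < p" and c: "c \<in> C" "y \<in> outer_nbrs C E c"
  shows "dense_cover_graph k w p q F (insert y C) E T" "card C < card (insert y C)"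
proof -
  have cg: "C \<subseteq> F" "E \<subseteq> C \<times> F" "\<And>c. c \<in> C \<Longrightarrow> card (outer_nbrs C E c) \<le> q"
    and dense: "card C \<le> Suc (card (E \<inter> C \<times> C))"
    using g unfolding dense_cover_graph_def cover_graph_def by auto
  have fin: "finite C" "finite E"
    using cg(1,2) \<open>finite F\<close> by (meson finite_SigmaI finite_subset)+
  have y: "y \<notin> C" "(c, y) \<in> E" "y \<in> F" using c cg(2) by (auto simp: outer_nbrs_def)
  then show "card C < card (insert y C)" using fin by simp
  have "outer_nbrs (insert y C) E y = {}" using y cg(2) by (auto simp: outer_nbrs_def)
  moreover have "card (outer_nbrs (insert y C) E d) \<le> card (outer_nbrs C E d)" for d
  proof (rule card_mono)
    show "finite (outer_nbrs C E d)"
      by (rule finite_subset[OF _ \<open>finite F\<close>]) (use cg(2) in \<open>auto simp: outer_nbrs_def\<close>)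
  qed (auto simp: outer_nbrs_def)
  ultimately have "card (outer_nbrs (insert y C) E d) \<le> q" if "d \<in> insert y C" for d
    using that cg(3) le_trans by fastforce
  moreover have "card (E \<inter> C \<times> C) < card (E \<inter> insert y C \<times> insert y C)"
    by (rule psubset_card_mono) (use fin y c(1) in auto)
  ultimately show "dense_cover_graph k w p q F (insert y C) E T"
    using g C fin y dense unfolding dense_cover_graph_def cover_graph_def by auto
qed

lemma exists_full_cover_graph:
  assumes F: "no_own_subset k F" "F \<noteq> {}" "finite F" "\<And>A. A \<in> F \<Longrightarrow> finite A \<and> card A = w"
    and k: "1 \<le> k" "k \<le> w" and p: "1 \<le> p" and q: "1 \<le> q"
    and large: "w \<le> k * (p * q + p - 1)"
  obtains C E T where "cover_graph p q F C E T" "card T = w"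
proof -
  let ?good = "\<lambda>(C, E, T). dense_cover_graph k w p q F C E T \<and> C \<noteq> {}"
  \<comment> \<open>Adding an edge enlarges \<open>T\<close> and keeps \<open>C\<close>; promotion
    enlarges \<open>C\<close> and keeps \<open>T\<close>. Both raise this sum, which is at most
    \<open>p + w\<close>, so at a maximum neither is possible.\<close>
  let ?size = "\<lambda>(C, E :: ('a set \<times> 'a set) set, T). card C + card T"
  obtain A where "A \<in> F" using F(2) by blast
  then have "?good ({A}, {}, {})"
    using p by (auto simp: dense_cover_graph_def cover_graph_def outer_nbrs_def)
  moreover have "\<forall>s. ?good s \<longrightarrow> ?size s < Suc (p + w)"
    by (auto simp: dense_cover_graph_def cover_graph_def)
  ultimately obtain s where s: "?good s" and smax: "\<forall>s'. ?good s' \<longrightarrow> ?size s' \<le> ?size s"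
    using ex_has_greatest_nat[of ?good _ ?size] by blast
  obtain C E T where CET: "s = (C, E, T)" by (cases s)
  have g: "dense_cover_graph k w p q F C E T" "C \<noteq> {}" using s CET by auto
  have maximal: "card C' + card T' \<le> card C + card T"
    if "dense_cover_graph k w p q F C' E' T'" "C' \<noteq> {}" for C' E' T'
    using smax that CET by fastforce
  have cg: "C \<subseteq> F" "E \<subseteq> C \<times> F" "card C \<le> p" "T \<subseteq> (\<Union>(c, y)\<in>E. c \<inter> y)"
    and dense: "card T \<le> w" "min w (k * card E) \<le> card T" "card C \<le> Suc (card (E \<inter> C \<times> C))"
    using g unfolding dense_cover_graph_def cover_graph_def by auto
  have fin: "finite C" "finite E"
    using cg(1,2) F(3) by (meson finite_SigmaI finite_subset)+
  have "(\<Union>(c, y)\<in>E. c \<inter> y) \<subseteq> \<Union>F" using cg(2) by auto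
  with cg(4) have "T \<subseteq> \<Union>F" by (rule subset_trans)
  moreover have "finite (\<Union>F)" using F(4) by (intro finite_Union[OF F(3)]) simp
  ultimately have finT: "finite T" by (rule finite_subset)
  have "card T = w"
  proof (rule ccontr)
    assume "card T \<noteq> w"
    then have lt: "card T < w" using dense(1) by simp
    have full: "q \<le> card (outer_nbrs C E c)" if "c \<in> C" for c
    proof (rule ccontr)
      assume "\<not> q \<le> card (outer_nbrs C E c)"
      then have "card (outer_nbrs C E c) < q" by simp
      with F(1,3,4) k g(1) lt finT that
      obtain E' T' where "dense_cover_graph k w p q F C E' T'" "card T < card T'"
        by (rule add_edge)
      with maximal[OF this(1) g(2)] show False by simp
    qed
    have "card C = p"
    proof (rule ccontr)
      assume "card C \<noteq> p"
      then have C: "card C < p" using cg(3) by simp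
      obtain c where c: "c \<in> C" using g(2) by blast
      then obtain y where "y \<in> outer_nbrs C E c" using full q by fastforce
      from promote_nbr[OF g(1) F(3) C c this] show False
        using maximal[of "insert y C" E T] by simp
    qed
    moreover have "card C * q + card (E \<inter> C \<times> C) \<le> card E"
      using card_edges_ge fin full by blast
    \<comment> \<open>Each of the \<open>p\<close> centres has \<open>q\<close> outer neighbours,
      and the invariant gives \<open>p - 1\<close> inner edges.\<close>
    ultimately have "p * q + p - 1 \<le> card E" using dense(3) by simp
    then have "k * (p * q + p - 1) \<le> k * card E" by simp
    then show False using large dense(2) lt by linarith
  qed
  then show ?thesis using that g(1) unfolding dense_cover_graph_def by blast
qed

section \<open>The bound for general \<open>p\<close> and \<open>q\<close>\<close>

lemma IPPS_card_le:
  assumes ipps: "is_IPPS t w v X B" and k: "1 \<le> k" "k \<le> w"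
    and pq: "1 \<le> p" "1 \<le> q" "p + q \<le> Suc t" "w \<le> k * (p * q + p - 1)"
  shows "card B \<le> v choose k"
proof (rule ccontr)
  have X: "finite X" "card X = v" "B \<subseteq> Pow X" and B: "\<And>A. A \<in> B \<Longrightarrow> card A = w"
    and par: "\<And>T. T \<subseteq> X \<Longrightarrow> card T = w \<Longrightarrow>
      parent_sets t B T = {} \<or> \<Inter>(parent_sets t B T) \<noteq> {}"
    using ipps by (auto simp: is_IPPS_def set_system_def w_subsets_def)
  assume "\<not> card B \<le> v choose k"
  then have "card X choose k < card B" using X(2) by simp
  with X(1,3) obtain F where F: "F \<subseteq> B" "F \<noteq> {}" "no_own_subset k F"
    by (rule exists_no_own_subset)
  have finF: "finite F" using F(1) X(1,3) by (meson finite_Pow_iff finite_subset subset_trans)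
  have blocks: "finite A \<and> card A = w" if "A \<in> F" for A
    using that F(1) X(1,3) B by (meson PowD finite_subset subsetD)
  obtain C E T where g: "cover_graph p q F C E T" "card T = w"
    by (rule exists_full_cover_graph[OF F(3,2) finF blocks k pq(1,2,4)])
  then have "E \<subseteq> C \<times> F" "T \<subseteq> (\<Union>(c, y)\<in>E. c \<inter> y)" unfolding cover_graph_def by simp_all
  moreover from this(1) have "(\<Union>(c, y)\<in>E. c \<inter> y) \<subseteq> \<Union>F" by auto
  moreover have "\<Union>F \<subseteq> X" using F(1) X(3) by auto
  ultimately have "T \<subseteq> X" by simp
  with par[OF _ g(2)] cover_graph_no_common_block[OF g(1) F(1) finF pq(2,3)] show False by blast
qed

section \<open>The exponent and the choice of \<open>p\<close> and \<open>q\<close>\<close>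

lemma IPPS_exponent_bounds:
  assumes "t \<ge> 2" "w \<ge> t"
  shows "1 \<le> IPPS_exponent t w" "IPPS_exponent t w \<le> w"
    "w \<le> IPPS_exponent t w * (t\<^sup>2 div 4 + t)"
proof -
  let ?d = "t\<^sup>2 div 4 + t"
  have "\<lfloor>(real t)\<^sup>2 / 4\<rfloor> = int (t\<^sup>2 div 4)"
    using floor_divide_of_nat_eq[of "t\<^sup>2" 4] by simp
  then have k: "IPPS_exponent t w = nat \<lceil>real w / real ?d\<rceil>"
    unfolding IPPS_exponent_def by simp
  have d: "1 \<le> real ?d" "0 < real w" using assms by auto
  then have "0 < real w / real ?d" by simp
  then have "0 < \<lceil>real w / real ?d\<rceil>" by simp
  then show "1 \<le> IPPS_exponent t w" unfolding k by linarith
  have "real w / real ?d \<le> real w / 1"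
    by (rule divide_left_mono) (use d in simp_all)
  then show "IPPS_exponent t w \<le> w" unfolding k div_by_1 by linarith
  have "real w / real ?d \<le> real (IPPS_exponent t w)" unfolding k by linarith
  then have "real w \<le> real (IPPS_exponent t w * ?d)" using d by (simp add: field_simps)
  then show "w \<le> IPPS_exponent t w * ?d" by linarith
qed

text \<open>Under \<open>p + q = t + 1\<close> the quantity
  \<open>p q + p - 1 = p (q + 1) - 1\<close> is largest when \<open>p\<close> and
  \<open>q + 1\<close> are as equal as possible, which is the choice made here.\<close>

lemma square_div_4_add:
  "(t div 2 + 1) * (t - t div 2) + (t div 2 + 1) - 1 = t\<^sup>2 div 4 + (t :: nat)"
proof (cases "even t")
  case True
  then obtain s where "t = 2 * s" by blast
  then show ?thesis by (simp add: power2_eq_square)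
next
  case False
  then obtain s where s: "t = 2 * s + 1" by (rule oddE)
  then have "t\<^sup>2 = 1 + 4 * (s * s + s)" by (simp add: power2_eq_square algebra_simps)
  then have "t\<^sup>2 div 4 = s * s + s" by simp
  then show ?thesis using s by (simp add: algebra_simps)
qed

theorem mainTheorem3:
  fixes t w :: nat
  assumes "t \<ge> 2" and "w \<ge> t"
  shows "(\<forall>v::nat. v \<ge> w \<longrightarrow> max_IPPS t w v \<le> v choose IPPS_exponent t w) \<and>
    (\<lambda>v::nat. real (v choose IPPS_exponent t w)) \<in> O[at_top](\<lambda>v. real v ^ IPPS_exponent t w)"
proof (intro conjI allI impI)
  let ?k = "IPPS_exponent t w"
  fix v :: nat
  have "n \<le> v choose ?k" if n: "n \<in> IPPS_sizes t w v" for n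
  proof -
    obtain X :: "nat set" and B where "is_IPPS t w v X B" "n = card B"
      using n unfolding IPPS_sizes_def by blast
    moreover have "1 \<le> t - t div 2" using assms(1) by linarith
    moreover have "w \<le> ?k * ((t div 2 + 1) * (t - t div 2) + (t div 2 + 1) - 1)"
      unfolding square_div_4_add by (rule IPPS_exponent_bounds(3)[OF assms])
    ultimately show ?thesis
      using IPPS_card_le[of t w v X B ?k "t div 2 + 1" "t - t div 2"]
        IPPS_exponent_bounds(1,2)[OF assms] by simp
  qed
  then show "max_IPPS t w v \<le> v choose ?k"
    unfolding max_IPPS_def using finite_IPPS_sizes IPPS_sizes_nonempty assms by simp
next
  let ?k = "IPPS_exponent t w"
  \<comment> \<open>For \<open>v < ?k\<close> the binomial coefficient is 0, so the constant 1 works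
    for every \<open>v\<close>.\<close>
  have "real (v choose ?k) \<le> real v ^ ?k" for v
    using binomial_le_pow[of ?k v] by (cases "?k \<le> v") (simp_all add: binomial_eq_0 flip: of_nat_power)
  then show "(\<lambda>v. real (v choose ?k)) \<in> O[at_top](\<lambda>v. real v ^ ?k)"
    by (intro bigoI[of _ 1]) simp
qed

end
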